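(* Let $(X,d,\mu)$ and $(X',d',\mu')$ be metric spaces with locally finite Borel measures, and let $D\subset X$ and $D'\subset X'$ be domains with finite Hausdorff dimensions $\alpha$ and $\alpha'>1$, respectively. Let $x_0\in\partial D$. Suppose that $D$ is locally path connected at $x_0$, that $X$ is upper $\lambda(r)$-regular at $x_0$ with $$\lambda(\varepsilon)=o\left(\varepsilon^{\alpha}\log^{\alpha-1}\frac{1}{\varepsilon}\right)\quad\text{as }\varepsilon\to 0,$$ that $\overline{D'}$ is compact, and that $\partial D'$ is strongly accessible. Let $Q:D\to[0,\infty]$ be a measurable function such that $$\limsup_{\varepsilon\to 0}\frac{1}{\mu(B(x_0,\varepsilon)\cap D)}\int_{B(x_0,\varepsilon)\cap D}Q(x)\,d\mu(x)<\infty .$$ Then any $Q$-homeomorphism $f:D\to D'$ can be extended to the point $x_0$ by continuity in $(X',d')$.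
   Context: A domain is an open path connected set. $B(x_0,r)=\{x\in X: d(x,x_0)<r\}$. Upper $\lambda(r)$-regularity: $(X,d,\mu)$ is upper $\lambda(r)$-regular at $x_0\in X$ if there are a constant $C>0$ and $r_0>0$ such that $\mu(B(x_0,r))\le C\lambda_{x_0}(r)$ for all $r<r_0$, where $\lambda=\lambda_{x_0}:(0,\infty)\to(0,\infty)$ is an increasing function. Locally path connected at a boundary point: $D$ is locally path connected at $x_0\in\partial D$ if for every neighborhood $U$ of $x_0$ there is a neighborhood $V\subseteq U$ of $x_0$ such that $V\cap D$ is path connected. Modulus: a Borel function $\varrho:X\to[0,\infty]$ is admissible for a family $\Gamma$ of paths in $X$ (written $\varrho\in\mathrm{adm}\,\Gamma$) if $\int_\gamma\varrho\,ds\ge1$ for all (locally rectifiable) $\gamma\in\Gamma$, with $ds$ arc length. For a family $\Gamma$ of paths in a domain $D\subset X$ of Hausdorff dimension $\alpha$, the modulus is $M(\Gamma)=\inf_{\varrho\in\mathrm{adm}\,\Gamma}\int_D\varrho^{\alpha}(x)\,d\mu(x)$. For path families in $D'\subset X'$ the modulus is defined in the same way with $D'$, $\mu'$ and the Hausdorff dimension $\alpha'$ of $D'$ in place of $D,\mu,\alpha$. $Q$-homeomorphism: a homeomorphism $f:D\to D'$ is a $Q$-homeomorphism if $M(f\Gamma)\le\int_D Q(x)\varrho^{\alpha}(x)\,d\mu(x)$ for every family $\Gamma$ of paths in $D$ and every admissible function $\varrho$ for $\Gamma$. A continuum is a compact connected space. $\Delta(E,F;D)$ denotes the family of all paths joining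 $E$ and $F$ in $D$. Strongly accessible boundary: the boundary of a domain $D$ is strongly accessible at $x_0\in\partial D$ if for every neighborhood $U$ of $x_0$ there are a compact set $E\subset D$, a neighborhood $V\subset U$ of $x_0$ and a number $\delta>0$ such that $M(\Delta(E,F;D))\ge\delta$ for every continuum $F$ in $D$ intersecting both $\partial U$ and $\partial V$. The boundary $\partial D$ is strongly accessible if this holds at every point of $\partial D$. (Here this is applied to $D'$ in $X'$.) *)

theory Defs
  imports "HOL-Analysis.Analysis"
begin

text \<open>Neighbourhoods of a point \<open>x\<close> are sets \<open>U\<close> with
  \<open>x \<in> interior U\<close>; they need not be open.\<close>

definition is_domain :: "'a::topological_space set \<Rightarrow> bool" where
  "is_domain D \<longleftrightarrow> open D \<and> path_connected D"

definition locally_path_connected_at_boundary :: "'a::topological_space set \<Rightarrow> 'a \<Rightarrow> bool" where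
  "locally_path_connected_at_boundary D x0 \<longleftrightarrow>
     (\<forall>U. x0 \<in> interior U \<longrightarrow> (\<exists>V \<subseteq> U. x0 \<in> interior V \<and> path_connected (V \<inter> D)))"

definition locally_finite_borel :: "'a::metric_space measure \<Rightarrow> bool" where
  "locally_finite_borel \<mu> \<longleftrightarrow>
     sets \<mu> = sets borel \<and> (\<forall>x. \<exists>r>0. emeasure \<mu> (ball x r) < \<infinity>)"

definition upper_regular_at ::
    "'a::metric_space measure \<Rightarrow> (real \<Rightarrow> real) \<Rightarrow> 'a \<Rightarrow> bool" where
  "upper_regular_at \<mu> lam x0 \<longleftrightarrow>
     (\<forall>r>0. 0 < lam r) \<and> mono_on {0<..} lam \<and>
     (\<exists>C>0. \<exists>r0>0. \<forall>r. 0 < r \<and> r < r0 \<longrightarrow> emeasure \<mu> (ball x0 r) \<le> ennreal (C * lam r))"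

text \<open>The term of a covering set is \<open>(diam S)\<^sup>s\<close>, with the
  conventions that it is \<open>0\<close> for empty \<open>S\<close> and \<open>0\<^sup>0 = 1\<close> for nonempty \<open>S\<close>
  (whereas \<open>0 powr 0 = 0\<close>). Covering sets are required to be bounded because
  \<open>diameter\<close> is real-valued.\<close>

definition hausdorff_gauge :: "real \<Rightarrow> 'a::metric_space set \<Rightarrow> ennreal" where
  "hausdorff_gauge s S =
     (if S = {} then 0 else if s = 0 then 1 else ennreal (diameter S powr s))"

definition hausdorff_premeasure :: "real \<Rightarrow> real \<Rightarrow> 'a::metric_space set \<Rightarrow> ennreal" where
  "hausdorff_premeasure s \<delta> A =
     (INF C \<in> {C :: nat \<Rightarrow> 'a set. A \<subseteq> (\<Union>i. C i) \<and> (\<forall>i. bounded (C i) \<and> diameter (C i) \<le> \<delta>)}.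
        \<Sum>i. hausdorff_gauge s (C i))"

definition hausdorff_measure :: "real \<Rightarrow> 'a::metric_space set \<Rightarrow> ennreal" where
  "hausdorff_measure s A = (SUP \<delta> \<in> {0<..}. hausdorff_premeasure s \<delta> A)"

definition hausdorff_dim :: "'a::metric_space set \<Rightarrow> ennreal" where
  "hausdorff_dim A = (INF s \<in> {s. 0 \<le> s \<and> hausdorff_measure s A = 0}. ennreal s)"

text \<open>A path is a pair \<open>(I, \<gamma>)\<close> of a nonempty (open, closed, half-open, possibly unbounded)
  interval \<open>I\<close> and a map continuous on \<open>I\<close>; the values of \<open>\<gamma>\<close> off \<open>I\<close> are irrelevant.\<close>

type_synonym 'a mpath = "real set \<times> (real \<Rightarrow> 'a)"

definition paths_in :: "'a::topological_space set \<Rightarrow> 'a mpath set" where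
  "paths_in D = {(I, \<gamma>). is_interval I \<and> I \<noteq> {} \<and> continuous_on I \<gamma> \<and> \<gamma> ` I \<subseteq> D}"

definition image_family :: "('a \<Rightarrow> 'b) \<Rightarrow> 'a mpath set \<Rightarrow> 'b mpath set" where
  "image_family f \<Gamma> = (\<lambda>(I, \<gamma>). (I, f \<circ> \<gamma>)) ` \<Gamma>"

definition joining_paths ::
    "'a::topological_space set \<Rightarrow> 'a set \<Rightarrow> 'a set \<Rightarrow> 'a mpath set" where
  "joining_paths E F D =
     {({a..b}, \<gamma>) | a b \<gamma>. a \<le> b \<and> continuous_on {a..b} \<gamma> \<and> \<gamma> ` {a..b} \<subseteq> D \<and>
                           \<gamma> a \<in> E \<and> \<gamma> b \<in> F}"

text \<open>Length of \<open>\<gamma>\<close> restricted to \<open>[a, b]\<close>, for \<open>a \<le> b\<close>: supremum over partitions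
  \<open>a = t\<^sub>0 \<le> \<dots> \<le> t\<^sub>n = b\<close>.\<close>

definition curve_length :: "(real \<Rightarrow> 'a::metric_space) \<Rightarrow> real \<Rightarrow> real \<Rightarrow> ennreal" where
  "curve_length \<gamma> a b =
     (SUP (n, t) \<in> {(n :: nat, t :: nat \<Rightarrow> real). mono_on {..n} t \<and> t 0 = a \<and> t n = b}.
        \<Sum>i<n. ennreal (dist (\<gamma> (t i)) (\<gamma> (t (Suc i)))))"

definition locally_rectifiable :: "'a::metric_space mpath \<Rightarrow> bool" where
  "locally_rectifiable = (\<lambda>(I, \<gamma>).
     \<forall>a\<in>I. \<forall>b\<in>I. a \<le> b \<longrightarrow> curve_length \<gamma> a b < \<infinity>)"

text \<open>Arc-length parametrization of \<open>\<gamma>\<close> on \<open>[a, b]\<close>. For continuous rectifiable \<open>\<gamma>\<close> the length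
  function attains every \<open>s\<close> between \<open>0\<close> and the total length, and the point obtained does not
  depend on the choice of the parameter.\<close>

definition arclength_param :: "(real \<Rightarrow> 'a::metric_space) \<Rightarrow> real \<Rightarrow> real \<Rightarrow> real \<Rightarrow> 'a" where
  "arclength_param \<gamma> a b s = \<gamma> (SOME t. t \<in> {a..b} \<and> curve_length \<gamma> a t = ennreal s)"

text \<open>The integral over a locally rectifiable path is the supremum of the integrals over its
  compact subpaths.\<close>

definition line_integral :: "('a::metric_space \<Rightarrow> ennreal) \<Rightarrow> 'a mpath \<Rightarrow> ennreal" where
  "line_integral \<rho> = (\<lambda>(I, \<gamma>).
     SUP (a, b) \<in> {(a, b). a \<in> I \<and> b \<in> I \<and> a \<le> b}.
       \<integral>\<^sup>+s \<in> {0..enn2real (curve_length \<gamma> a b)}. \<rho> (arclength_param \<gamma> a b s) \<partial>lborel)"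

definition admissible :: "'a::metric_space mpath set \<Rightarrow> ('a \<Rightarrow> ennreal) \<Rightarrow> bool" where
  "admissible \<Gamma> \<rho> \<longleftrightarrow> \<rho> \<in> borel_measurable borel \<and>
     (\<forall>\<gamma>\<in>\<Gamma>. locally_rectifiable \<gamma> \<longrightarrow> 1 \<le> line_integral \<rho> \<gamma>)"

text \<open>Real powers on \<open>[0, \<infinity>]\<close>, for exponents \<open>p > 0\<close>.\<close>

definition ennreal_powr :: "ennreal \<Rightarrow> real \<Rightarrow> ennreal" where
  "ennreal_powr x p = (if x = \<infinity> then \<infinity> else ennreal (enn2real x powr p))"

text \<open>The exponent in the modulus is the Hausdorff dimension of the domain, which is assumed
  finite wherever these notions are used.\<close>

definition modulus :: "'a::metric_space measure \<Rightarrow> 'a set \<Rightarrow> 'a mpath set \<Rightarrow> ennreal" where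
  "modulus \<mu> D \<Gamma> =
     (INF \<rho> \<in> {\<rho>. admissible \<Gamma> \<rho>}.
        \<integral>\<^sup>+x \<in> D. ennreal_powr (\<rho> x) (enn2real (hausdorff_dim D)) \<partial>\<mu>)"

definition Q_homeomorphism ::
    "'a::metric_space measure \<Rightarrow> 'a set \<Rightarrow> 'b::metric_space measure \<Rightarrow> 'b set \<Rightarrow>
     ('a \<Rightarrow> ennreal) \<Rightarrow> ('a \<Rightarrow> 'b) \<Rightarrow> bool" where
  "Q_homeomorphism \<mu> D \<mu>' D' Q f \<longleftrightarrow>
     (\<exists>g. homeomorphism D D' f g) \<and>
     (\<forall>\<Gamma> \<subseteq> paths_in D. \<forall>\<rho>. admissible \<Gamma> \<rho> \<longrightarrow>
        modulus \<mu>' D' (image_family f \<Gamma>)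
          \<le> (\<integral>\<^sup>+x \<in> D. Q x * ennreal_powr (\<rho> x) (enn2real (hausdorff_dim D)) \<partial>\<mu>))"

definition strongly_accessible_at :: "'a::metric_space measure \<Rightarrow> 'a set \<Rightarrow> 'a \<Rightarrow> bool" where
  "strongly_accessible_at \<mu> D x0 \<longleftrightarrow>
     (\<forall>U. x0 \<in> interior U \<longrightarrow>
        (\<exists>E V. \<exists>\<delta>::real. compact E \<and> E \<subseteq> D \<and> x0 \<in> interior V \<and> V \<subseteq> U \<and> 0 < \<delta> \<and>
           (\<forall>F. compact F \<and> connected F \<and> F \<subseteq> D \<and>
                F \<inter> frontier U \<noteq> {} \<and> F \<inter> frontier V \<noteq> {} \<longrightarrow>
                ennreal \<delta> \<le> modulus \<mu> D (joining_paths E F D))))"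

definition strongly_accessible_boundary :: "'a::metric_space measure \<Rightarrow> 'a set \<Rightarrow> bool" where
  "strongly_accessible_boundary \<mu> D \<longleftrightarrow> (\<forall>x0 \<in> frontier D. strongly_accessible_at \<mu> D x0)"

end

theory Submission
  imports Defs
begin

text \<open>If \<open>f\<close> has no limit at \<open>x0\<close>, compactness gives a cluster value \<open>y\<close>, which lies in the boundary of
  \<open>D'\<close>, and arbitrarily small neighbourhoods \<open>W\<close> of \<open>x0\<close> with path connected \<open>W \<inter> D\<close> whose images join points near \<open>y\<close> to points at
  a fixed distance from \<open>y\<close>. Strong accessibility bounds from below the modulus of the paths from
  a fixed compact \<open>E\<close> to such an image. These paths come from paths crossing the ring
  \<open>2\<^sup>-\<^sup>2\<^sup>m < d(x, x0) < 2\<^sup>-\<^sup>m\<close>, so the \<open>Q\<close>-inequality bounds that modulus by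
  \<open>\<integral> Q \<rho>\<^sup>\<alpha> d\<mu>\<close> with \<open>\<rho>\<close> a dyadic discretization of \<open>1 / (m log 2 \<cdot> d(x, x0))\<close> on the ring. On
  the \<open>k\<close>-th dyadic annulus this integral is \<open>o(k powr (\<alpha> - 1) / m powr \<alpha>)\<close>; as \<open>m \<le> k < 2 * m\<close>,
  this is \<open>o(1 / m)\<close> whatever the value of \<open>\<alpha> \<ge> 0\<close>, and the sum over the \<open>m\<close> annuli tends to \<open>0\<close>.\<close>

section \<open>Length and arc-length parametrization\<close>

lemma sum_dist_le_curve_length:
  assumes "mono_on {..n} t" "t 0 = a" "t n = b"
  shows "(\<Sum>i<n. ennreal (dist (\<gamma> (t i)) (\<gamma> (t (Suc i))))) \<le> curve_length \<gamma> a b"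
  unfolding curve_length_def
  by (rule SUP_upper2[of "(n, t)"]) (use assms in auto)

lemma curve_length_leI:
  assumes "\<And>n t. mono_on {..n} t \<Longrightarrow> t 0 = a \<Longrightarrow> t n = b \<Longrightarrow>
             (\<Sum>i<n. ennreal (dist (\<gamma> (t i)) (\<gamma> (t (Suc i))))) \<le> c"
  shows "curve_length \<gamma> a b \<le> c"
  unfolding curve_length_def using assms by (auto intro!: SUP_least)

lemma less_curve_lengthE:
  assumes "y < curve_length \<gamma> a b"
  obtains n t where "mono_on {..n} t" "t 0 = a" "t n = b"
    "y < (\<Sum>i<n. ennreal (dist (\<gamma> (t i)) (\<gamma> (t (Suc i)))))"
  using assms curve_length_leI[of a b \<gamma> y] by (meson not_le)

lemma dist_le_curve_length:
  assumes "a \<le> b"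
  shows "ennreal (dist (\<gamma> a) (\<gamma> b)) \<le> curve_length \<gamma> a b"
  using sum_dist_le_curve_length[of 1 "\<lambda>i. if i = 0 then a else b" a b \<gamma>] assms
  by (simp add: mono_on_def)

text \<open>A partition of \<open>[a, c]\<close> followed by one of \<open>[c, b]\<close> is a
  partition of \<open>[a, b]\<close> whose inscribed sum is the sum of the two; then take
  suprema.\<close>

lemma curve_length_add_le:
  assumes "a \<le> c" "c \<le> b"
  shows "curve_length \<gamma> a c + curve_length \<gamma> c b \<le> curve_length \<gamma> a b"
proof -
  let ?S = "\<lambda>(n::nat, t). (\<Sum>i<n. ennreal (dist (\<gamma> (t i)) (\<gamma> (t (Suc i)))))"
  let ?P = "\<lambda>a b. {(n::nat, t::nat \<Rightarrow> real). mono_on {..n} t \<and> t 0 = a \<and> t n = b}"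
  have ne: "?P a b \<noteq> {}" if "a \<le> b" for a b
  proof -
    have "(1, \<lambda>i. if i = 0 then a else b) \<in> ?P a b"
      using that by (auto simp: mono_on_def)
    then show ?thesis by blast
  qed
  have key: "?S (n, t) + ?S (m, u) \<le> curve_length \<gamma> a b"
    if t: "mono_on {..n} t" "t 0 = a" "t n = c" and u: "mono_on {..m} u" "u 0 = c" "u m = b"
    for n t m u
  proof -
    define v where "v i = (if i \<le> n then t i else u (i - n))" for i
    \<comment> \<open>The last point of \<open>t\<close> and the first point of \<open>u\<close> are
      both \<open>c\<close>, so the formula also holds at \<open>i = 0\<close>.\<close>
    have v_u: "v (n + i) = u i" for i
      using t u by (cases i) (auto simp: v_def)
    have "mono_on {..n + m} v"
    proof (rule mono_onI)
      fix i j :: nat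
      assume ij: "i \<in> {..n + m}" "j \<in> {..n + m}" "i \<le> j"
      have "t i \<le> t n" if "i \<le> n" using t that by (auto simp: mono_on_def)
      moreover have "u 0 \<le> u (j - n)" using u ij by (auto simp: mono_on_def)
      moreover have "u (i - n) \<le> u (j - n)" using u ij by (intro mono_onD[OF u(1)]) auto
      ultimately show "v i \<le> v j"
        using ij t u by (auto simp: v_def mono_on_def)
    qed
    moreover have "v 0 = a" "v (n + m) = b"
      using t u v_u by (auto simp: v_def)
    ultimately have "?S (n + m, v) \<le> curve_length \<gamma> a b"
      by (simp only: prod.case sum_dist_le_curve_length)
    moreover have "?S (n + m, v) = ?S (n, v) + (\<Sum>i<m. ennreal (dist (\<gamma> (v (n + i))) (\<gamma> (v (n + Suc i)))))"
      by (induction m) (simp_all add: add.assoc del: sum_ennreal)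
    moreover have "?S (n, v) = ?S (n, t)"
      by (simp add: v_def)
    ultimately show ?thesis
      by (simp add: v_u del: add_Suc_right)
  qed
  \<comment> \<open>The suprema are taken one after the other; a summand moves under
    \<open>SUP\<close> only for a nonempty index set, hence \<open>ne\<close>.\<close>
  have "?S p + curve_length \<gamma> c b \<le> curve_length \<gamma> a b" if "p \<in> ?P a c" for p
    unfolding curve_length_def[of \<gamma> c b]
    using that key by (subst ennreal_SUP_add_right[OF ne[OF assms(2)]]) (auto intro!: SUP_least)
  then show ?thesis
    unfolding curve_length_def[of \<gamma> a c]
    by (subst ennreal_SUP_add_left[OF ne[OF assms(1)], symmetric]) (auto intro!: SUP_least)
qed

text \<open>For the upper bound, replace each partition point \<open>x\<close> by
  \<open>min x c\<close> and by \<open>max x c\<close>. This gives partitions of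
  \<open>[a, c]\<close> and \<open>[c, b]\<close>, and the triangle inequality is used only on a
  step that jumps over \<open>c\<close>.\<close>

lemma curve_length_split:
  assumes "a \<le> c" "c \<le> b"
  shows "curve_length \<gamma> a b = curve_length \<gamma> a c + curve_length \<gamma> c b"
proof (rule antisym)
  show "curve_length \<gamma> a b \<le> curve_length \<gamma> a c + curve_length \<gamma> c b"
  proof (rule curve_length_leI)
    fix n and t :: "nat \<Rightarrow> real"
    assume t: "mono_on {..n} t" "t 0 = a" "t n = b"
    let ?l = "\<lambda>i. min (t i) c" and ?r = "\<lambda>i. max (t i) c"
    have "(\<Sum>i<n. ennreal (dist (\<gamma> (t i)) (\<gamma> (t (Suc i)))))
        \<le> (\<Sum>i<n. ennreal (dist (\<gamma> (?l i)) (\<gamma> (?l (Suc i)))) + ennreal (dist (\<gamma> (?r i)) (\<gamma> (?r (Suc i)))))"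
    proof (rule sum_mono)
      fix i assume "i \<in> {..<n}"
      then have "t i \<le> t (Suc i)"
        using t by (auto simp: mono_on_def)
      then have "dist (\<gamma> (t i)) (\<gamma> (t (Suc i)))
          \<le> dist (\<gamma> (?l i)) (\<gamma> (?l (Suc i))) + dist (\<gamma> (?r i)) (\<gamma> (?r (Suc i)))"
        by (auto simp: min_def max_def dist_triangle)
      then show "ennreal (dist (\<gamma> (t i)) (\<gamma> (t (Suc i))))
          \<le> ennreal (dist (\<gamma> (?l i)) (\<gamma> (?l (Suc i)))) + ennreal (dist (\<gamma> (?r i)) (\<gamma> (?r (Suc i))))"
        by (simp add: ennreal_leI flip: ennreal_plus)
    qed
    also have "\<dots> \<le> curve_length \<gamma> a c + curve_length \<gamma> c b"
      unfolding sum.distrib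
      by (intro add_mono sum_dist_le_curve_length)
         (use t assms in \<open>auto simp: mono_on_def min.coboundedI1 max.coboundedI1\<close>)
    finally show "(\<Sum>i<n. ennreal (dist (\<gamma> (t i)) (\<gamma> (t (Suc i))))) \<le> curve_length \<gamma> a c + curve_length \<gamma> c b" .
  qed
qed (rule curve_length_add_le[OF assms])

lemma curve_length_mono:
  assumes "a \<le> c" "c \<le> d" "d \<le> b"
  shows "curve_length \<gamma> c d \<le> curve_length \<gamma> a b"
  using curve_length_split[of a c b \<gamma>] curve_length_split[of c d b \<gamma>] assms
  by (simp add: add_increasing add_increasing2)

lemma curve_length_finite:
  assumes "a \<le> c" "c \<le> d" "d \<le> b" "curve_length \<gamma> a b < \<infinity>"
  shows "curve_length \<gamma> c d < \<infinity>"
  using curve_length_mono[OF assms(1-3)] assms(4) by (rule order.strict_trans1)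

lemma curve_length_cong:
  assumes "\<And>t. t \<in> {a..b} \<Longrightarrow> \<gamma> t = \<gamma>' t"
  shows "curve_length \<gamma> a b = curve_length \<gamma>' a b"
  unfolding curve_length_def
proof (rule SUP_cong[OF refl], clarify)
  fix n and t :: "nat \<Rightarrow> real"
  assume t: "mono_on {..n} t" "a = t 0" "b = t n"
  have "t i \<in> {a..b}" if "i \<le> n" for i
    using t that by (auto simp: mono_on_def)
  then show "(\<Sum>i<n. ennreal (dist (\<gamma> (t i)) (\<gamma> (t (Suc i)))))
      = (\<Sum>i<n. ennreal (dist (\<gamma>' (t i)) (\<gamma>' (t (Suc i)))))"
    using assms by (intro sum.cong) auto
qed

text \<open>Clamping a fixed partition to \<open>[p x, q x]\<close> gives inscribed sums that converge to the
  inscribed sum of the partition.\<close>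

lemma curve_length_lower_semicontinuous:
  assumes cont: "continuous_on {a..b} \<gamma>"
    and p: "(p \<longlongrightarrow> c) A" and q: "(q \<longlongrightarrow> d) A"
    and ev: "\<forall>\<^sub>F x in A. a \<le> p x \<and> p x \<le> q x \<and> q x \<le> b"
    and cd: "a \<le> c" "c \<le> d" "d \<le> b"
    and y: "y < curve_length \<gamma> c d"
  shows "\<forall>\<^sub>F x in A. y < curve_length \<gamma> (p x) (q x)"
proof -
  obtain n t where t: "mono_on {..n} t" "t 0 = c" "t n = d"
    and yt: "y < (\<Sum>i<n. ennreal (dist (\<gamma> (t i)) (\<gamma> (t (Suc i)))))"
    using less_curve_lengthE[OF y] by blast
  define s where "s x i = max (p x) (min (q x) (t i))" for x i
  have t_cd: "t i \<in> {c..d}" if "i \<le> n" for i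
    using t that by (auto simp: mono_on_def)
  have lim: "((\<lambda>x. \<gamma> (s x i)) \<longlongrightarrow> \<gamma> (t i)) A" if "i \<le> n" for i
  proof (rule continuous_on_tendsto_compose[OF cont])
    have "((\<lambda>x. s x i) \<longlongrightarrow> max c (min d (t i))) A"
      unfolding s_def by (intro tendsto_intros p q)
    then show "((\<lambda>x. s x i) \<longlongrightarrow> t i) A"
      using t_cd[OF that] by (simp add: min_absorb2 max_absorb2)
    show "t i \<in> {a..b}"
      using t_cd[OF that] cd by auto
    show "\<forall>\<^sub>F x in A. s x i \<in> {a..b}"
      using ev by eventually_elim (auto simp: s_def)
  qed
  have "((\<lambda>x. \<Sum>i<n. ennreal (dist (\<gamma> (s x i)) (\<gamma> (s x (Suc i)))))
          \<longlongrightarrow> (\<Sum>i<n. ennreal (dist (\<gamma> (t i)) (\<gamma> (t (Suc i)))))) A"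
    by (intro tendsto_sum tendsto_ennrealI tendsto_dist lim) auto
  then have "\<forall>\<^sub>F x in A. y < (\<Sum>i<n. ennreal (dist (\<gamma> (s x i)) (\<gamma> (s x (Suc i)))))"
    using yt by (rule order_tendstoD)
  then show ?thesis
    using ev
  proof eventually_elim
    case (elim x)
    have "(\<Sum>i<n. ennreal (dist (\<gamma> (s x i)) (\<gamma> (s x (Suc i))))) \<le> curve_length \<gamma> (s x 0) (s x n)"
    proof (rule sum_dist_le_curve_length)
      show "mono_on {..n} (s x)"
        unfolding s_def by (intro mono_onI max.mono min.mono order_refl mono_onD[OF t(1)])
    qed auto
    \<comment> \<open>The clamped partition runs from \<open>s x 0\<close> to \<open>s x n\<close>,
      which need not be \<open>p x\<close> and \<open>q x\<close>; monotonicity of length makes up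
      for this.\<close>
    also have "\<dots> \<le> curve_length \<gamma> (p x) (q x)"
      by (rule curve_length_mono) (use elim t cd in \<open>auto simp: s_def max_def min_def\<close>)
    finally show ?case
      using elim by simp
  qed
qed

text \<open>The lengths of \<open>[a, t]\<close> and of \<open>[t, b]\<close> are both lower
  semicontinuous in \<open>t\<close>. Their sum is a finite constant, so lower semicontinuity of the
  second is upper semicontinuity of the first.\<close>

lemma continuous_on_curve_length:
  assumes cont: "continuous_on {a..b} \<gamma>" and fin: "curve_length \<gamma> a b < \<infinity>"
  shows "continuous_on {a..b} (\<lambda>t. enn2real (curve_length \<gamma> a t))"
  unfolding continuous_on_def
proof
  fix t assume t: "t \<in> {a..b}"
  let ?A = "at t within {a..b}"
  let ?l = "\<lambda>t. enn2real (curve_length \<gamma> a t)" and ?r = "\<lambda>t. enn2real (curve_length \<gamma> t b)"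
  have ab: "ennreal (enn2real (curve_length \<gamma> c d)) = curve_length \<gamma> c d" if "a \<le> c" "c \<le> d" "d \<le> b" for c d
    using curve_length_finite[OF that fin] by simp
  have sum: "?r s = ?l b - ?l s" if "s \<in> {a..b}" for s
  proof -
    have "ennreal (?l b) = ennreal (?l s + ?r s)"
      using curve_length_split[of a s b \<gamma>] ab[of a s] ab[of s b] ab[of a b] that
      by (simp add: ennreal_plus)
    then show ?thesis
      by (subst (asm) ennreal_inj) auto
  qed
  have ev: "\<forall>\<^sub>F s in ?A. s \<in> {a..b}"
    by (simp add: eventually_at_filter)
  have lim: "((\<lambda>s. s) \<longlongrightarrow> t) ?A" by (rule tendsto_ident_at)
  \<comment> \<open>Negative \<open>y\<close> are treated apart because \<open>ennreal\<close> sends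
    them to \<open>0\<close>, which would destroy the strict inequality.\<close>
  have lower: "\<forall>\<^sub>F s in ?A. y < ?l s" if y: "y < ?l t" for y
  proof (cases "y < 0")
    case True
    then show ?thesis
      by (intro always_eventually allI) (rule order.strict_trans2[OF _ enn2real_nonneg])
  next
    case False
    then have "ennreal y < curve_length \<gamma> a t"
      using y t by (subst ab[symmetric]) (auto simp: ennreal_less_iff)
    then have "\<forall>\<^sub>F s in ?A. ennreal y < curve_length \<gamma> a s"
      by (intro curve_length_lower_semicontinuous[OF cont tendsto_const lim])
         (use t in \<open>auto intro: eventually_mono[OF ev]\<close>)
    then show ?thesis
      using ev
    proof eventually_elim
      case (elim s)
      then have "ennreal y < ennreal (enn2real (curve_length \<gamma> a s))"
        by (subst ab) auto
      then show ?case
        using False by (simp add: ennreal_less_iff)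
    qed
  qed
  have lower': "\<forall>\<^sub>F s in ?A. y < ?r s" if y: "y < ?r t" for y
  proof (cases "y < 0")
    case True
    then show ?thesis
      by (intro always_eventually allI) (rule order.strict_trans2[OF _ enn2real_nonneg])
  next
    case False
    then have "ennreal y < curve_length \<gamma> t b"
      using y t by (subst ab[symmetric]) (auto simp: ennreal_less_iff)
    then have "\<forall>\<^sub>F s in ?A. ennreal y < curve_length \<gamma> s b"
      by (intro curve_length_lower_semicontinuous[OF cont lim tendsto_const])
         (use t in \<open>auto intro: eventually_mono[OF ev]\<close>)
    then show ?thesis
      using ev
    proof eventually_elim
      case (elim s)
      then have "ennreal y < ennreal (enn2real (curve_length \<gamma> s b))"
        by (subst ab) auto
      then show ?case
        using False by (simp add: ennreal_less_iff)
    qed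
  qed
  show "(?l \<longlongrightarrow> ?l t) ?A"
  proof (rule order_tendstoI)
    fix y assume "?l t < y"
    then have "\<forall>\<^sub>F s in ?A. ?l b - y < ?r s"
      using sum[OF t] by (intro lower') linarith
    then show "\<forall>\<^sub>F s in ?A. ?l s < y"
      using ev
    proof eventually_elim
      case (elim s)
      then show ?case using sum[of s] by linarith
    qed
  qed (rule lower)
qed

section \<open>Arc-length parametrization and crossings of levels\<close>

lemma ennreal_add_eq_selfD:
  fixes x y :: ennreal
  assumes "x + y = x" "x < \<infinity>"
  shows "y = 0"
  using assms by (cases x; cases y) (auto simp flip: ennreal_plus)

text \<open>The length function is continuous and rises from \<open>0\<close> to the total length,
  so the intermediate value theorem provides a parameter for \<open>SOME\<close> to choose.\<close>

lemma arclength_param_witness: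
  assumes cont: "continuous_on {a..b} \<gamma>" and "a \<le> b" and fin: "curve_length \<gamma> a b < \<infinity>"
    and s: "s \<in> {0..enn2real (curve_length \<gamma> a b)}"
  defines "t \<equiv> (SOME t. t \<in> {a..b} \<and> curve_length \<gamma> a t = ennreal s)"
  shows "t \<in> {a..b}" "curve_length \<gamma> a t = ennreal s" "arclength_param \<gamma> a b s = \<gamma> t"
proof -
  \<comment> \<open>A degenerate interval has length \<open>0\<close>, since additivity at
    \<open>a\<close> gives \<open>l + l = l\<close> with \<open>l\<close> finite.\<close>
  have "curve_length \<gamma> a a + curve_length \<gamma> a a = curve_length \<gamma> a a"
    using curve_length_split[of a a a \<gamma>] by simp
  moreover have "curve_length \<gamma> a a < \<infinity>"
    using curve_length_finite[of a a a b \<gamma>] \<open>a \<le> b\<close> fin by simp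
  ultimately have 0: "curve_length \<gamma> a a = 0"
    by (rule ennreal_add_eq_selfD)
  obtain u where u: "u \<in> {a..b}" "enn2real (curve_length \<gamma> a u) = s"
    using IVT'[of "\<lambda>t. enn2real (curve_length \<gamma> a t)" a s b] s \<open>a \<le> b\<close> 0
      continuous_on_curve_length[OF cont fin] by auto
  have "curve_length \<gamma> a u < \<infinity>"
    using curve_length_finite[of a a u b \<gamma>] u fin by simp
  then have "\<exists>t. t \<in> {a..b} \<and> curve_length \<gamma> a t = ennreal s"
    using u by (intro exI[of _ u]) auto
  then have "t \<in> {a..b} \<and> curve_length \<gamma> a t = ennreal s"
    unfolding t_def by (rule someI_ex)
  then show "t \<in> {a..b}" "curve_length \<gamma> a t = ennreal s" by auto
  show "arclength_param \<gamma> a b s = \<gamma> t"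
    by (simp add: arclength_param_def t_def)
qed

text \<open>By additivity the piece of the path between the two chosen parameters has length
  \<open>\<bar>s - s'\<bar>\<close>, and a chord is no longer than its arc.\<close>

lemma dist_arclength_param_le:
  assumes "continuous_on {a..b} \<gamma>" "a \<le> b" "curve_length \<gamma> a b < \<infinity>"
    and "s \<in> {0..enn2real (curve_length \<gamma> a b)}" "s' \<in> {0..enn2real (curve_length \<gamma> a b)}"
  shows "dist (arclength_param \<gamma> a b s) (arclength_param \<gamma> a b s') \<le> \<bar>s - s'\<bar>"
proof -
  have le: "dist (\<gamma> t) (\<gamma> t') \<le> r' - r"
    if "a \<le> t" "t \<le> t'" "curve_length \<gamma> a t = ennreal r" "curve_length \<gamma> a t' = ennreal r'"
      "0 \<le> r" "0 \<le> r'" for t t' r r'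
  proof -
    have "ennreal r' = ennreal r + curve_length \<gamma> t t'"
      using curve_length_split[of a t t' \<gamma>] that by simp
    then have "ennreal (r + dist (\<gamma> t) (\<gamma> t')) \<le> ennreal r'"
      using dist_le_curve_length[of t t' \<gamma>] that by (simp add: add_left_mono)
    then show ?thesis
      using that by (simp add: ennreal_le_iff flip: ennreal_plus)
  qed
  obtain t where t: "t \<in> {a..b}" "curve_length \<gamma> a t = ennreal s" "arclength_param \<gamma> a b s = \<gamma> t"
    using arclength_param_witness[OF assms(1-4)] by blast
  obtain t' where t': "t' \<in> {a..b}" "curve_length \<gamma> a t' = ennreal s'" "arclength_param \<gamma> a b s' = \<gamma> t'"
    using arclength_param_witness[OF assms(1-3,5)] by blast
  show ?thesis
  proof (cases "t \<le> t'")
    case True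
    then show ?thesis using le[of t t' s s'] t t' assms(4,5) by auto
  next
    case False
    then show ?thesis using le[of t' t s' s] t t' assms(4,5) by (auto simp: dist_commute)
  qed
qed

text \<open>The parameter chosen for \<open>0\<close> need not be \<open>a\<close>, but the path has
  length \<open>0\<close> between the two and is therefore constant there; likewise at
  \<open>b\<close>.\<close>

lemma arclength_param_endpoints:
  assumes "continuous_on {a..b} \<gamma>" "a \<le> b" "curve_length \<gamma> a b < \<infinity>"
  shows "arclength_param \<gamma> a b 0 = \<gamma> a"
    "arclength_param \<gamma> a b (enn2real (curve_length \<gamma> a b)) = \<gamma> b"
proof -
  obtain t where t: "t \<in> {a..b}" "curve_length \<gamma> a t = ennreal 0" "arclength_param \<gamma> a b 0 = \<gamma> t"
    using arclength_param_witness[OF assms, of 0] by auto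
  then show "arclength_param \<gamma> a b 0 = \<gamma> a"
    using dist_le_curve_length[of a t \<gamma>] by auto
  let ?L = "enn2real (curve_length \<gamma> a b)"
  obtain t where t: "t \<in> {a..b}" "curve_length \<gamma> a t = ennreal ?L" "arclength_param \<gamma> a b ?L = \<gamma> t"
    using arclength_param_witness[OF assms, of ?L] by auto
  then have "curve_length \<gamma> a b = curve_length \<gamma> a b + curve_length \<gamma> t b"
    using curve_length_split[of a t b \<gamma>] assms(3) by (metis atLeastAtMost_iff ennreal_enn2real infinity_ennreal_def)
  then have "curve_length \<gamma> t b = 0"
    using assms(3) by (intro ennreal_add_eq_selfD) auto
  then show "arclength_param \<gamma> a b ?L = \<gamma> b"
    using dist_le_curve_length[of t b \<gamma>] t by auto
qed

text \<open>Let \<open>s1\<close> be the last time with \<open>u \<ge> q\<close> and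
  \<open>s2\<close> the first time from \<open>s1\<close> on with \<open>u \<le> p\<close>. In
  between \<open>u\<close> stays strictly between the levels, and the Lipschitz bound turns the drop
  \<open>q - p\<close> into elapsed time.\<close>

lemma downcrossing:
  fixes u :: "real \<Rightarrow> real"
  assumes lip: "1-lipschitz_on {0..L} u" and "0 \<le> L" and "q \<le> u 0" "u L \<le> p"
  obtains s1 s2 where "0 \<le> s1" "s2 \<le> L" "q - p \<le> s2 - s1" "s1 \<le> s2"
    "\<And>s. s1 < s \<Longrightarrow> s < s2 \<Longrightarrow> p < u s \<and> u s < q"
proof -
  have cont: "continuous_on {0..L} u"
    using lip by (rule lipschitz_on_continuous_on)
  define S where "S = {0..L} \<inter> u -` {q..}"
  have "closed S"
    unfolding S_def by (rule continuous_closed_preimage[OF cont]) simp_all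
  then have "compact S"
    unfolding compact_eq_bounded_closed
    using bounded_subset[OF bounded_closed_interval[of 0 L], of S] by (simp add: S_def)
  moreover have "0 \<in> S"
    using assms(2,3) by (simp add: S_def)
  ultimately obtain s1 where s1: "s1 \<in> S" and s1_max: "\<And>s. s \<in> S \<Longrightarrow> s \<le> s1"
    using compact_attains_sup[of S] by auto
  define T where "T = {s1..L} \<inter> u -` {..p}"
  have "continuous_on {s1..L} u"
    by (rule continuous_on_subset[OF cont]) (use s1 in \<open>auto simp: S_def\<close>)
  then have "closed T"
    unfolding T_def by (rule continuous_closed_preimage) simp_all
  then have "compact T"
    unfolding compact_eq_bounded_closed
    using bounded_subset[OF bounded_closed_interval[of s1 L], of T] by (simp add: T_def)
  moreover have "L \<in> T"
    using assms(4) s1 by (simp add: T_def S_def)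
  ultimately obtain s2 where s2: "s2 \<in> T" and s2_min: "\<And>s. s \<in> T \<Longrightarrow> s2 \<le> s"
    using compact_attains_inf[of T] by auto
  have "dist (u s1) (u s2) \<le> 1 * dist s1 s2"
    by (rule lipschitz_onD[OF lip]) (use s1 s2 in \<open>auto simp: S_def T_def\<close>)
  then have "q - p \<le> s2 - s1"
    using s1 s2 by (auto simp: S_def T_def dist_real_def)
  moreover have "p < u s \<and> u s < q" if "s1 < s" "s < s2" for s
  proof -
    have "s \<notin> S" "s \<notin> T"
      using s1_max[of s] s2_min[of s] that by auto
    then show ?thesis
      using s1 s2 that unfolding S_def T_def by auto
  qed
  moreover have "0 \<le> s1" "s2 \<le> L" "s1 \<le> s2"
    using s1 s2 unfolding S_def T_def by auto
  ultimately show ?thesis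
    by (intro that)
qed

section \<open>Line integrals and modulus\<close>

text \<open>Along the arc-length parametrization the distance to \<open>x0\<close> is 1-Lipschitz.
  Each annulus is crossed from its outer to its inner radius, so the path spends arc length at least
  \<open>q k - p k\<close> in it. The estimates are added term by term, so the annuli may
  overlap.\<close>

lemma line_integral_annuli_ge:
  fixes x0 :: "'a::metric_space" and p q :: "'k \<Rightarrow> real" and c :: "'k \<Rightarrow> ennreal"
  assumes cont: "continuous_on {a..b} \<gamma>" and ab: "a \<le> b"
    and rect: "locally_rectifiable ({a..b}, \<gamma>)"
    and q: "\<And>k. k \<in> K \<Longrightarrow> q k \<le> dist (\<gamma> a) x0"
    and p: "\<And>k. k \<in> K \<Longrightarrow> dist (\<gamma> b) x0 \<le> p k"
  shows "(\<Sum>k\<in>K. c k * ennreal (q k - p k))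
    \<le> line_integral (\<lambda>x. \<Sum>k\<in>K. c k * indicator {x. p k \<le> dist x x0 \<and> dist x x0 < q k} x) ({a..b}, \<gamma>)"
    (is "_ \<le> line_integral ?\<rho> _")
proof -
  define L where "L = enn2real (curve_length \<gamma> a b)"
  define u where "u s = dist (arclength_param \<gamma> a b s) x0" for s
  have fin: "curve_length \<gamma> a b < \<infinity>"
    using rect ab unfolding locally_rectifiable_def by auto
  have "1-lipschitz_on {0..L} u"
  proof (rule lipschitz_onI)
    fix s s' assume "s \<in> {0..L}" "s' \<in> {0..L}"
    then have "dist (arclength_param \<gamma> a b s) (arclength_param \<gamma> a b s') \<le> \<bar>s - s'\<bar>"
      unfolding L_def by (rule dist_arclength_param_le[OF cont ab fin])
    then show "dist (u s) (u s') \<le> 1 * dist s s'"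
      using abs_dist_diff_le[of "arclength_param \<gamma> a b s" x0 "arclength_param \<gamma> a b s'"]
      by (simp add: u_def dist_real_def dist_commute)
  qed simp
  then have "\<exists>s1 s2. 0 \<le> s1 \<and> s2 \<le> L \<and> q k - p k \<le> s2 - s1 \<and> s1 \<le> s2 \<and>
      (\<forall>s. s1 < s \<longrightarrow> s < s2 \<longrightarrow> p k < u s \<and> u s < q k)" if "k \<in> K" for k
  proof (rule downcrossing[of L u "q k" "p k"])
    show "0 \<le> L" "q k \<le> u 0" "u L \<le> p k"
      using q[OF that] p[OF that] arclength_param_endpoints[OF cont ab fin] by (auto simp: u_def L_def)
  qed blast
  \<comment> \<open>The endpoints \<open>s1\<close> and \<open>s2\<close> are packed into one pair
    so that a single choice over \<open>K\<close> suffices.\<close>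
  then have "\<forall>k\<in>K. \<exists>w. 0 \<le> fst w \<and> snd w \<le> L \<and> q k - p k \<le> snd w - fst w \<and> fst w \<le> snd w \<and>
      (\<forall>s. fst w < s \<longrightarrow> s < snd w \<longrightarrow> p k < u s \<and> u s < q k)"
    by (simp add: split_paired_Ex)
  then obtain w where w: "\<forall>k\<in>K. 0 \<le> fst (w k) \<and> snd (w k) \<le> L \<and>
      q k - p k \<le> snd (w k) - fst (w k) \<and> fst (w k) \<le> snd (w k) \<and>
      (\<forall>s. fst (w k) < s \<longrightarrow> s < snd (w k) \<longrightarrow> p k < u s \<and> u s < q k)"
    by (rule bchoice[THEN exE])
  define l r where "l k = fst (w k)" and "r k = snd (w k)" for k
  have lr: "0 \<le> l k" "r k \<le> L" "q k - p k \<le> r k - l k" "l k \<le> r k"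
      "\<And>s. l k < s \<Longrightarrow> s < r k \<Longrightarrow> p k < u s \<and> u s < q k" if "k \<in> K" for k
    using w that by (auto simp: l_def r_def)
  have "(\<Sum>k\<in>K. c k * ennreal (q k - p k)) \<le> (\<Sum>k\<in>K. c k * ennreal (r k - l k))"
    by (intro sum_mono mult_left_mono ennreal_leI lr) auto
  also have "\<dots> = (\<integral>\<^sup>+s. (\<Sum>k\<in>K. c k * indicator {l k<..<r k} s) \<partial>lborel)"
    using lr by (subst nn_integral_sum) (auto simp: nn_integral_cmult_indicator intro!: sum.cong)
  also have "\<dots> \<le> (\<integral>\<^sup>+s \<in> {0..L}. ?\<rho> (arclength_param \<gamma> a b s) \<partial>lborel)"
  proof (rule nn_integral_mono)
    fix s
    have "(\<Sum>k\<in>K. c k * indicator {l k<..<r k} s)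
      \<le> (\<Sum>k\<in>K. c k * indicator {x. p k \<le> dist x x0 \<and> dist x x0 < q k} (arclength_param \<gamma> a b s) * indicator {0..L} s)"
    proof (intro sum_mono)
      fix k assume k: "k \<in> K"
      have "s \<in> {0..L} \<and> p k \<le> u s \<and> u s < q k" if "s \<in> {l k<..<r k}"
        using lr(1)[OF k] lr(2)[OF k] lr(5)[OF k, of s] that by auto
      then show "c k * indicator {l k<..<r k} s
          \<le> c k * indicator {x. p k \<le> dist x x0 \<and> dist x x0 < q k} (arclength_param \<gamma> a b s) * indicator {0..L} s"
        by (auto simp: indicator_def u_def)
    qed
    then show "(\<Sum>k\<in>K. c k * indicator {l k<..<r k} s) \<le> ?\<rho> (arclength_param \<gamma> a b s) * indicator {0..L} s"
      by (simp add: sum_distrib_right)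
  qed
  also have "\<dots> \<le> line_integral ?\<rho> ({a..b}, \<gamma>)"
    unfolding line_integral_def prod.case L_def
    by (rule SUP_upper2[of "(a, b)"]) (use ab in auto)
  finally show ?thesis .
qed

section \<open>Independence of values off the interval, and transport of path families by
  \<open>f\<close>\<close>

lemma locally_rectifiable_cong:
  assumes "\<And>t. t \<in> {a..b} \<Longrightarrow> \<gamma> t = \<gamma>' t"
  shows "locally_rectifiable ({a..b}, \<gamma>) \<longleftrightarrow> locally_rectifiable ({a..b}, \<gamma>')"
proof -
  have "curve_length \<gamma> c d = curve_length \<gamma>' c d" if "c \<in> {a..b}" "d \<in> {a..b}" for c d
    using assms that by (intro curve_length_cong) auto
  then show ?thesis
    by (simp add: locally_rectifiable_def)
qed

text \<open>Continuity and rectifiability guarantee that the \<open>SOME\<close> in \<open>arclength_param\<close> picks a parameter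
  in the interval; otherwise the values of the path off the interval might matter.\<close>

lemma line_integral_cong:
  assumes eq: "\<And>t. t \<in> {a..b} \<Longrightarrow> \<gamma> t = \<gamma>' t"
    and cont: "continuous_on {a..b} \<gamma>" and rect: "locally_rectifiable ({a..b}, \<gamma>)"
  shows "line_integral \<rho> ({a..b}, \<gamma>) = line_integral \<rho> ({a..b}, \<gamma>')"
  unfolding line_integral_def prod.case
proof (rule SUP_cong[OF refl], clarify)
  fix c d assume cd: "c \<in> {a..b}" "d \<in> {a..b}" "c \<le> d"
  let ?L = "enn2real (curve_length \<gamma> c d)"
  have len: "curve_length \<gamma> c t = curve_length \<gamma>' c t" if "t \<in> {c..d}" for t
    using eq cd that by (intro curve_length_cong) auto
  have cont': "continuous_on {c..d} \<gamma>"
    by (rule continuous_on_subset[OF cont]) (use cd in auto)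
  have fin: "curve_length \<gamma> c d < \<infinity>"
    using rect cd unfolding locally_rectifiable_def by auto
  have "arclength_param \<gamma> c d s = arclength_param \<gamma>' c d s" if s: "s \<in> {0..?L}" for s
  proof -
    have "(SOME t. t \<in> {c..d} \<and> curve_length \<gamma> c t = ennreal s)
        = (SOME t. t \<in> {c..d} \<and> curve_length \<gamma>' c t = ennreal s)"
      using len by (intro arg_cong[of _ _ Eps] ext) auto
    moreover have "(SOME t. t \<in> {c..d} \<and> curve_length \<gamma> c t = ennreal s) \<in> {c..d}"
      using arclength_param_witness(1)[OF cont' cd(3) fin s] .
    then have "(SOME t. t \<in> {c..d} \<and> curve_length \<gamma> c t = ennreal s) \<in> {a..b}"
      using cd by auto
    ultimately show ?thesis
      using eq by (simp add: arclength_param_def)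
  qed
  then have "(\<integral>\<^sup>+s \<in> {0..?L}. \<rho> (arclength_param \<gamma> c d s) \<partial>lborel)
      = (\<integral>\<^sup>+s \<in> {0..?L}. \<rho> (arclength_param \<gamma>' c d s) \<partial>lborel)"
    by (intro nn_integral_cong) (simp add: indicator_def)
  then show "(\<integral>\<^sup>+s \<in> {0..?L}. \<rho> (arclength_param \<gamma> c d s) \<partial>lborel)
      = (\<integral>\<^sup>+s \<in> {0..enn2real (curve_length \<gamma>' c d)}. \<rho> (arclength_param \<gamma>' c d s) \<partial>lborel)"
    using len[of d] cd by simp
qed

text \<open>The two families differ only in the values of paths off their parameter intervals: \<open>f\<close> need
  not map onto the whole space, so not every extension occurs in the image family.\<close>

lemma modulus_joining_paths_le_image:
  assumes hom: "homeomorphism D D' f g"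
  shows "modulus \<mu> D' (joining_paths E F D')
    \<le> modulus \<mu> D' (image_family f (joining_paths (g ` E) (g ` F) D))"
proof -
  \<comment> \<open>It suffices that every density admissible for the image family is admissible for
    the family in \<open>D'\<close>: the infimum on the left then runs over a larger set. A path
    \<gamma> in \<open>D'\<close> agrees on its interval with the image of
    \<open>g \<circ> \<gamma>\<close>.\<close>
  have "admissible (joining_paths E F D') \<rho>"
    if adm: "admissible (image_family f (joining_paths (g ` E) (g ` F) D)) \<rho>" for \<rho>
    unfolding admissible_def
  proof (intro conjI ballI impI)
    show "\<rho> \<in> borel_measurable borel"
      using adm by (simp add: admissible_def)
    fix \<pi> assume "\<pi> \<in> joining_paths E F D'" and rect: "locally_rectifiable \<pi>"
    then obtain a b \<gamma> where \<pi>: "\<pi> = ({a..b}, \<gamma>)" and \<gamma>: "a \<le> b" "continuous_on {a..b} \<gamma>"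
        "\<gamma> ` {a..b} \<subseteq> D'" "\<gamma> a \<in> E" "\<gamma> b \<in> F"
      by (auto simp: joining_paths_def)
    have "continuous_on {a..b} (g \<circ> \<gamma>)"
      using \<gamma> by (intro continuous_on_compose continuous_on_subset[OF homeomorphism_cont2[OF hom]])
    moreover have "(g \<circ> \<gamma>) ` {a..b} \<subseteq> D"
      using \<gamma> homeomorphism_image2[OF hom] by auto
    ultimately have "({a..b}, g \<circ> \<gamma>) \<in> joining_paths (g ` E) (g ` F) D"
      using \<gamma> by (auto simp: joining_paths_def)
    then have img: "({a..b}, f \<circ> (g \<circ> \<gamma>)) \<in> image_family f (joining_paths (g ` E) (g ` F) D)"
      unfolding image_family_def by (rule rev_image_eqI) simp
    have eq: "\<gamma> t = (f \<circ> (g \<circ> \<gamma>)) t" if "t \<in> {a..b}" for t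
    proof -
      have "\<gamma> t \<in> D'"
        using \<gamma> that by blast
      then show ?thesis
        using homeomorphism_apply2[OF hom] by simp
    qed
    have "locally_rectifiable ({a..b}, f \<circ> (g \<circ> \<gamma>))"
      by (rule iffD1[OF locally_rectifiable_cong[of a b \<gamma>]], erule eq) (use rect \<pi> in simp)
    then have "1 \<le> line_integral \<rho> ({a..b}, f \<circ> (g \<circ> \<gamma>))"
      using adm img by (simp add: admissible_def)
    also have "\<dots> = line_integral \<rho> \<pi>"
      unfolding \<pi> by (rule line_integral_cong[symmetric], erule eq) (use \<gamma> rect \<pi> in simp_all)
    finally show "1 \<le> line_integral \<rho> \<pi>" .
  qed
  then show ?thesis
    unfolding modulus_def by (intro INF_superset_mono) auto
qed

section \<open>The dyadic density\<close>

text \<open>Half-open, so that distinct annuli are disjoint.\<close>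

definition dyadic_annulus :: "'a::metric_space \<Rightarrow> nat \<Rightarrow> 'a set" where
  "dyadic_annulus x0 k = {x. (1/2) ^ Suc k \<le> dist x x0 \<and> dist x x0 < (1/2) ^ k}"

text \<open>The weight is the reciprocal of \<open>m\<close> times the thickness of the annulus, so
  crossing any one of the \<open>m\<close> annuli contributes at least \<open>1 / m\<close>.\<close>

definition dyadic_density :: "'a::metric_space \<Rightarrow> nat \<Rightarrow> 'a \<Rightarrow> ennreal" where
  "dyadic_density x0 m x =
     (\<Sum>k\<in>{m..<2 * m}. ennreal (2 ^ Suc k / real m) * indicator (dyadic_annulus x0 k) x)"

lemma borel_dyadic_annulus [measurable]: "dyadic_annulus x0 k \<in> sets borel"
proof -
  have "dyadic_annulus x0 k = ball x0 ((1/2) ^ k) - ball x0 ((1/2) ^ Suc k)"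
    by (auto simp: dyadic_annulus_def dist_commute simp del: power_Suc)
  then show ?thesis by simp
qed

lemma borel_measurable_dyadic_density [measurable]: "dyadic_density x0 m \<in> borel_measurable borel"
  unfolding dyadic_density_def
  by (intro borel_measurable_sum borel_measurable_times_ennreal borel_measurable_const
        borel_measurable_indicator borel_dyadic_annulus)

lemma dyadic_annulus_unique:
  assumes "x \<in> dyadic_annulus x0 j" "x \<in> dyadic_annulus x0 k"
  shows "j = k"
proof -
  have "\<not> i < l" if "x \<in> dyadic_annulus x0 i" "x \<in> dyadic_annulus x0 l" for i l
  proof
    assume "i < l"
    then have "(1/2::real) ^ l \<le> (1/2) ^ Suc i"
      by (intro power_decreasing) auto
    then show False
      using that unfolding dyadic_annulus_def mem_Collect_eq by linarith
  qed
  then show ?thesis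
    using assms by (meson linorder_neqE_nat)
qed

text \<open>At most one annulus contains \<open>x\<close>, so both sums collapse to one term and the
  power moves inside. Off all annuli the left side vanishes even for \<open>\<alpha> = 0\<close>,
  because \<open>0 powr 0 = 0\<close>.\<close>

lemma ennreal_powr_dyadic_density_le:
  "ennreal_powr (dyadic_density x0 m x) \<alpha>
    \<le> (\<Sum>k\<in>{m..<2 * m}. ennreal ((2 ^ Suc k / real m) powr \<alpha>) * indicator (dyadic_annulus x0 k) x)"
proof (cases "\<exists>j\<in>{m..<2 * m}. x \<in> dyadic_annulus x0 j")
  case True
  then obtain j where j: "j \<in> {m..<2 * m}" "x \<in> dyadic_annulus x0 j" by blast
  have sum_eq: "(\<Sum>k\<in>{m..<2 * m}. h k * indicator (dyadic_annulus x0 k) x) = h j"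
    for h :: "nat \<Rightarrow> ennreal"
  proof -
    have "(\<Sum>k\<in>{m..<2 * m}. h k * indicator (dyadic_annulus x0 k) x)
        = (\<Sum>k\<in>{j}. h k * indicator (dyadic_annulus x0 k) x)"
    proof (rule sum.mono_neutral_right)
      have "x \<notin> dyadic_annulus x0 k" if "k \<noteq> j" for k
        using dyadic_annulus_unique[OF j(2), of k] that by blast
      then show "\<forall>k\<in>{m..<2 * m} - {j}. h k * indicator (dyadic_annulus x0 k) x = 0"
        by simp
    qed (use j(1) in simp_all)
    then show ?thesis using j(2) by simp
  qed
  show ?thesis
    unfolding dyadic_density_def sum_eq by (simp add: ennreal_powr_def del: power_Suc)
next
  case False
  then have "dyadic_density x0 m x = 0"
    by (simp add: dyadic_density_def indicator_def)
  then show ?thesis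
    by (simp add: ennreal_powr_def)
qed

text \<open>Each annulus is enlarged to the ball of its outer radius, because the control of
  \<open>Q\<close> is a control of averages over balls.\<close>

lemma nn_integral_dyadic_density_le:
  assumes \<mu>: "sets \<mu> = sets borel" and D: "open D"
    and Q: "Q \<in> borel_measurable (restrict_space \<mu> D)"
  shows "(\<integral>\<^sup>+x \<in> D. Q x * ennreal_powr (dyadic_density x0 m x) \<alpha> \<partial>\<mu>)
    \<le> (\<Sum>k\<in>{m..<2 * m}. ennreal ((2 ^ Suc k / real m) powr \<alpha>) *
           (\<integral>\<^sup>+x \<in> ball x0 ((1/2) ^ k) \<inter> D. Q x \<partial>\<mu>))"
proof -
  let ?c = "\<lambda>k. ennreal ((2 ^ Suc k / real m) powr \<alpha>)"
  let ?B = "\<lambda>k. ball x0 ((1/2) ^ k) \<inter> D"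
  \<comment> \<open>\<open>Q\<close> is measurable only on \<open>D\<close>; as \<open>D\<close> is
    open, its extension by \<open>0\<close> is measurable on the whole space.\<close>
  have "(\<lambda>x. Q x * indicator D x) \<in> borel_measurable \<mu>"
    using Q D \<mu> by (subst (asm) borel_measurable_restrict_space_iff_ennreal) auto
  moreover have "indicator (ball x0 ((1/2) ^ k)) \<in> borel_measurable \<mu>" for k
    by (rule borel_measurable_indicator) (simp add: \<mu>)
  ultimately have "(\<lambda>x. Q x * indicator D x * indicator (ball x0 ((1/2) ^ k)) x) \<in> borel_measurable \<mu>" for k
    by (rule borel_measurable_times_ennreal)
  moreover have "(\<lambda>x. Q x * indicator D x * indicator (ball x0 ((1/2) ^ k)) x)
      = (\<lambda>x. Q x * indicator (?B k) x)" for k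
    by (rule ext) (simp split: split_indicator)
  ultimately have meas: "(\<lambda>x. Q x * indicator (?B k) x) \<in> borel_measurable \<mu>" for k
    by metis
  have meas': "(\<lambda>x. ?c k * (Q x * indicator (?B k) x)) \<in> borel_measurable \<mu>" for k
    by (rule borel_measurable_times_ennreal[OF borel_measurable_const meas])
  have "(\<integral>\<^sup>+x \<in> D. Q x * ennreal_powr (dyadic_density x0 m x) \<alpha> \<partial>\<mu>)
      \<le> (\<integral>\<^sup>+x. (\<Sum>k\<in>{m..<2 * m}. ?c k * (Q x * indicator (?B k) x)) \<partial>\<mu>)"
  proof (rule nn_integral_mono)
    fix x
    have "Q x * ennreal_powr (dyadic_density x0 m x) \<alpha> * indicator D x
        \<le> Q x * (\<Sum>k\<in>{m..<2 * m}. ?c k * indicator (dyadic_annulus x0 k) x) * indicator D x"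
      by (intro mult_right_mono mult_left_mono ennreal_powr_dyadic_density_le) auto
    also have "\<dots> = (\<Sum>k\<in>{m..<2 * m}. ?c k * (Q x * (indicator (dyadic_annulus x0 k) x * indicator D x)))"
      unfolding sum_distrib_left sum_distrib_right by (intro sum.cong refl) (simp only: mult_ac)
    also have "\<dots> \<le> (\<Sum>k\<in>{m..<2 * m}. ?c k * (Q x * indicator (?B k) x))"
    proof (intro sum_mono mult_left_mono)
      show "indicator (dyadic_annulus x0 k) x * indicator D x \<le> (indicator (?B k) x :: ennreal)" for k
        by (simp add: dyadic_annulus_def dist_commute split: split_indicator)
    qed simp_all
    finally show "Q x * ennreal_powr (dyadic_density x0 m x) \<alpha> * indicator D x
        \<le> (\<Sum>k\<in>{m..<2 * m}. ?c k * (Q x * indicator (?B k) x))" .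
  qed
  also have "\<dots> = (\<Sum>k\<in>{m..<2 * m}. ?c k * (\<integral>\<^sup>+x \<in> ?B k. Q x \<partial>\<mu>))"
    by (simp only: nn_integral_sum[OF meas'] nn_integral_cmult[OF meas])
  finally show ?thesis .
qed

text \<open>For small radii the average of \<open>Q\<close> is below some finite \<open>K\<close>,
  so the integral is at most \<open>K\<close> times the measure of the ball, hence at most
  \<open>K * C * lam \<epsilon>\<close>; the little-o hypothesis then gives any constant
  \<open>c\<close>.\<close>

lemma eventually_nn_integral_ball_le:
  assumes \<mu>: "sets \<mu> = sets borel" and D: "open D"
    and reg: "upper_regular_at \<mu> lam x0"
    and lam: "lam \<in> o[at_right 0](\<lambda>\<epsilon>. \<epsilon> powr \<alpha> * ln (1 / \<epsilon>) powr (\<alpha> - 1))"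
    and Q: "Limsup (at_right 0)
           (\<lambda>\<epsilon>. (\<integral>\<^sup>+x \<in> ball x0 \<epsilon> \<inter> D. Q x \<partial>\<mu>) / emeasure \<mu> (ball x0 \<epsilon> \<inter> D)) < \<infinity>"
    and c: "0 < c"
  shows "\<forall>\<^sub>F \<epsilon> in at_right 0. (\<integral>\<^sup>+x \<in> ball x0 \<epsilon> \<inter> D. Q x \<partial>\<mu>)
           \<le> ennreal (c * (\<epsilon> powr \<alpha> * ln (1 / \<epsilon>) powr (\<alpha> - 1)))"
proof -
  let ?I = "\<lambda>\<epsilon>. \<integral>\<^sup>+x \<in> ball x0 \<epsilon> \<inter> D. Q x \<partial>\<mu>"
  let ?h = "\<lambda>\<epsilon>. \<epsilon> powr \<alpha> * ln (1 / \<epsilon>) powr (\<alpha> - 1)"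
  obtain K' where K': "Limsup (at_right 0) (\<lambda>\<epsilon>. ?I \<epsilon> / emeasure \<mu> (ball x0 \<epsilon> \<inter> D)) < K'" "K' < \<infinity>"
    using dense[OF Q] by blast
  then obtain K where K: "K' = ennreal K" "0 \<le> K"
    by (cases K') auto
  obtain C r0 where C: "C > 0" "r0 > 0"
      "\<And>r. 0 < r \<Longrightarrow> r < r0 \<Longrightarrow> emeasure \<mu> (ball x0 r) \<le> ennreal (C * lam r)"
    using reg unfolding upper_regular_at_def by blast
  have lam_pos: "0 < lam r" if "0 < r" for r
    using reg that unfolding upper_regular_at_def by blast
  \<comment> \<open>Chosen so that \<open>K * C * d \<le> c\<close>; the summand \<open>1\<close>
    keeps the denominator positive when \<open>K = 0\<close>.\<close>
  define d where "d = c / (K * C + 1)"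
  have KC: "0 < K * C + 1"
    using K C by (simp add: add_nonneg_pos)
  then have d: "0 < d"
    using c by (simp add: d_def)
  have "\<forall>\<^sub>F \<epsilon> in at_right 0. ?I \<epsilon> / emeasure \<mu> (ball x0 \<epsilon> \<inter> D) < ennreal K"
    using Limsup_lessD[OF K'(1)] K by simp
  moreover have "\<forall>\<^sub>F \<epsilon> in at_right 0. norm (lam \<epsilon>) \<le> d * norm (?h \<epsilon>)"
    using lam d by (rule landau_o.smallD)
  moreover have "\<forall>\<^sub>F \<epsilon> in at_right 0. 0 < \<epsilon> \<and> \<epsilon> < r0"
    using C by (auto simp: eventually_at_right_field)
  ultimately show ?thesis
  proof eventually_elim
    case (elim \<epsilon>)
    let ?B = "ball x0 \<epsilon> \<inter> D"
    have B: "emeasure \<mu> ?B \<le> ennreal (C * lam \<epsilon>)"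
      using C(3)[of \<epsilon>] elim emeasure_mono[of ?B "ball x0 \<epsilon>" \<mu>] \<mu> by (auto intro: order.trans)
    then have B_fin: "emeasure \<mu> ?B < top"
      by (rule order.strict_trans1) simp
    \<comment> \<open>The bound on the quotient can be multiplied out only for nonzero measure; over
      a null set the integral is \<open>0\<close>.\<close>
    have "?I \<epsilon> \<le> ennreal K * emeasure \<mu> ?B"
    proof (cases "emeasure \<mu> ?B = 0")
      case True
      then have "?B \<in> null_sets \<mu>"
        using D \<mu> by (intro null_setsI) auto
      then have "?I \<epsilon> = 0"
        by (rule nn_integral_null_set)
      then show ?thesis by simp
    next
      case False
      then show ?thesis
        using divide_less_ennreal[OF False B_fin] elim(1) by (simp add: less_imp_le)
    qed
    also have "\<dots> \<le> ennreal K * ennreal (C * lam \<epsilon>)"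
      by (intro mult_left_mono B) auto
    also have "\<dots> = ennreal (K * C * lam \<epsilon>)"
      using K by (simp add: ennreal_mult' mult.assoc)
    also have "\<dots> \<le> ennreal (c * ?h \<epsilon>)"
    proof (rule ennreal_leI)
      have le: "lam \<epsilon> \<le> d * ?h \<epsilon>"
        using elim(2) by simp
      have "K * C * lam \<epsilon> \<le> (K * C + 1) * lam \<epsilon>"
        using lam_pos[of \<epsilon>] elim(3) by (simp add: distrib_right)
      also have "\<dots> \<le> (K * C + 1) * (d * ?h \<epsilon>)"
        using KC le by (intro mult_left_mono) auto
      also have "\<dots> = c * ?h \<epsilon>"
        using KC by (simp add: d_def)
      finally show "K * C * lam \<epsilon> \<le> c * ?h \<epsilon>" .
    qed
    finally show ?case .
  qed
qed

text \<open>The powers of \<open>2 ^ k\<close> cancel and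
  \<open>ln (1 / (1/2) ^ k) = k * ln 2\<close>. What remains is
  \<open>k powr (\<alpha> - 1) / m powr \<alpha>\<close> up to constants, and \<open>k\<close> is
  comparable to \<open>m\<close>.\<close>

lemma dyadic_term_le:
  fixes \<alpha> c :: real and k m :: nat
  assumes "0 \<le> \<alpha>" "0 \<le> c" "0 < m" "m \<le> k" "k < 2 * m"
  shows "(2 ^ Suc k / real m) powr \<alpha> *
      (c * (((1/2) ^ k) powr \<alpha> * ln (1 / (1/2) ^ k) powr (\<alpha> - 1)))
    \<le> c * (4 powr \<alpha> * ln 2 powr (\<alpha> - 1)) / real m"
proof -
  have k: "0 < real k" using assms by simp
  \<comment> \<open>The sign of \<open>\<alpha> - 1\<close> decides which bound on \<open>k\<close>
    is used: \<open>k < 2 * m\<close> if \<open>1 \<le> \<alpha>\<close>, and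
    \<open>m \<le> k\<close> otherwise.\<close>
  have "real k powr (\<alpha> - 1) \<le> 2 powr \<alpha> * real m powr (\<alpha> - 1)"
  proof (cases "1 \<le> \<alpha>")
    case True
    have "real k powr (\<alpha> - 1) \<le> (2 * real m) powr (\<alpha> - 1)"
      using True assms by (intro powr_mono2) auto
    also have "\<dots> = 2 powr (\<alpha> - 1) * real m powr (\<alpha> - 1)"
      by (simp add: powr_mult)
    also have "\<dots> \<le> 2 powr \<alpha> * real m powr (\<alpha> - 1)"
      by (intro mult_right_mono powr_mono) auto
    finally show ?thesis .
  next
    case False
    have "real k powr (\<alpha> - 1) \<le> 1 * real m powr (\<alpha> - 1)"
      using False assms powr_mono2'[of "\<alpha> - 1" "real m" "real k"]
      by simp
    also have "\<dots> \<le> 2 powr \<alpha> * real m powr (\<alpha> - 1)"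
      using assms by (intro mult_right_mono ge_one_powr_ge_zero) auto
    finally show ?thesis .
  qed
  then have le: "real k powr (\<alpha> - 1) / real m powr \<alpha> \<le> 2 powr \<alpha> / real m"
    using assms by (simp add: powr_diff field_simps)
  have "(2 ^ Suc k / real m) powr \<alpha> * ((1/2) ^ k) powr \<alpha> = (2 / real m) powr \<alpha>"
    by (simp add: powr_mult[symmetric] power_divide)
  moreover have "ln (1 / (1/2::real) ^ k) = real k * ln 2"
    by (simp add: power_divide ln_realpow)
  ultimately have "(2 ^ Suc k / real m) powr \<alpha> *
      (c * (((1/2) ^ k) powr \<alpha> * ln (1 / (1/2) ^ k) powr (\<alpha> - 1)))
      = c * (2 / real m) powr \<alpha> * (real k * ln 2) powr (\<alpha> - 1)"
    by (simp add: mult.assoc[symmetric] mult.commute[of _ c])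
  also have "\<dots> = c * (2 powr \<alpha> * ln 2 powr (\<alpha> - 1)) * (real k powr (\<alpha> - 1) / real m powr \<alpha>)"
    by (simp add: powr_divide powr_mult)
  also have "\<dots> \<le> c * (2 powr \<alpha> * ln 2 powr (\<alpha> - 1)) * (2 powr \<alpha> / real m)"
    using assms by (intro mult_left_mono le) auto
  also have "\<dots> = c * (4 powr \<alpha> * ln 2 powr (\<alpha> - 1)) / real m"
    using powr_mult[of 2 2 \<alpha>] by simp
  finally show ?thesis .
qed

text \<open>With \<open>A\<close> the constant of \<open>dyadic_term_le\<close> and
  \<open>c = \<eta> / A\<close>, each of the \<open>m\<close> terms is at most
  \<open>\<eta> / m\<close> as soon as all radii are small.\<close>

lemma eventually_dyadic_sum_le:
  fixes I :: "real \<Rightarrow> ennreal" and \<alpha> \<eta> :: real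
  assumes \<alpha>: "0 \<le> \<alpha>" and \<eta>: "0 < \<eta>"
    and I: "\<And>c. 0 < c \<Longrightarrow> \<forall>\<^sub>F \<epsilon> in at_right 0. I \<epsilon> \<le> ennreal (c * (\<epsilon> powr \<alpha> * ln (1 / \<epsilon>) powr (\<alpha> - 1)))"
  shows "\<forall>\<^sub>F m in sequentially.
    (\<Sum>k\<in>{m..<2 * m}. ennreal ((2 ^ Suc k / real m) powr \<alpha>) * I ((1/2) ^ k)) \<le> ennreal \<eta>"
proof -
  define A where "A = 4 powr \<alpha> * ln 2 powr (\<alpha> - 1)"
  have A: "0 < A" by (simp add: A_def)
  define c where "c = \<eta> / A"
  have c: "0 < c" using A \<eta> by (simp add: c_def)
  have "filterlim (\<lambda>k. (1/2::real) ^ k) (at_right 0) sequentially"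
    by (rule tendsto_imp_filterlim_at_right) (auto intro!: LIMSEQ_power_zero)
  then have "\<forall>\<^sub>F k in sequentially. I ((1/2) ^ k)
      \<le> ennreal (c * (((1/2) ^ k) powr \<alpha> * ln (1 / (1/2) ^ k) powr (\<alpha> - 1)))"
    using I[OF c] by (rule eventually_compose_filterlim[rotated])
  then obtain N where N: "\<And>k. N \<le> k \<Longrightarrow> I ((1/2) ^ k)
      \<le> ennreal (c * (((1/2) ^ k) powr \<alpha> * ln (1 / (1/2) ^ k) powr (\<alpha> - 1)))"
    by (auto simp: eventually_sequentially)
  \<comment> \<open>The strict inequality also gives \<open>0 < m\<close>, needed for dividing by
    \<open>m\<close>.\<close>
  have "\<forall>\<^sub>F m in sequentially. N < m"
    by (rule eventually_gt_at_top)
  then show ?thesis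
  proof eventually_elim
    case (elim m)
    have "(\<Sum>k\<in>{m..<2 * m}. ennreal ((2 ^ Suc k / real m) powr \<alpha>) * I ((1/2) ^ k))
        \<le> (\<Sum>k\<in>{m..<2 * m}. ennreal (c * A / real m))"
    proof (rule sum_mono)
      fix k assume k: "k \<in> {m..<2 * m}"
      let ?x = "(2 ^ Suc k / real m) powr \<alpha>"
      let ?y = "c * (((1/2) ^ k) powr \<alpha> * ln (1 / (1/2) ^ k) powr (\<alpha> - 1))"
      have "ennreal ?x * I ((1/2) ^ k) \<le> ennreal ?x * ennreal ?y"
        using k elim by (intro mult_left_mono N) auto
      also have "\<dots> = ennreal (?x * ?y)"
        by (rule ennreal_mult'[symmetric]) simp
      also have "\<dots> \<le> ennreal (c * A / real m)"
        unfolding A_def using k elim \<alpha> c by (intro ennreal_leI dyadic_term_le) auto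
      finally show "ennreal ?x * I ((1/2) ^ k) \<le> ennreal (c * A / real m)" .
    qed
    also have "\<dots> = ennreal \<eta>"
      using elim A \<eta> by (simp add: c_def ennreal_of_nat_eq_real_of_nat ennreal_mult'[symmetric])
    finally show ?case .
  qed
qed

section \<open>Boundary extension\<close>

text \<open>Every path of the family crosses all \<open>m\<close> annuli inwards, and each crossing
  contributes at least weight times thickness, which is \<open>1 / m\<close>.\<close>

lemma admissible_dyadic_density:
  assumes m: "0 < m"
    and E: "\<And>x. x \<in> E \<Longrightarrow> (1/2) ^ m \<le> dist x x0"
    and F: "\<And>x. x \<in> F \<Longrightarrow> dist x x0 \<le> (1/2) ^ (2 * m)"
  shows "admissible (joining_paths E F D) (dyadic_density x0 m)"
  unfolding admissible_def
proof (intro conjI ballI impI)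
  fix \<pi> assume "\<pi> \<in> joining_paths E F D" and rect: "locally_rectifiable \<pi>"
  then obtain a b \<gamma> where \<pi>: "\<pi> = ({a..b}, \<gamma>)" and \<gamma>: "a \<le> b" "continuous_on {a..b} \<gamma>"
      "\<gamma> a \<in> E" "\<gamma> b \<in> F"
    by (auto simp: joining_paths_def)
  have "ennreal (2 ^ Suc k / real m) * ennreal ((1/2) ^ k - (1/2) ^ Suc k) = ennreal (1 / real m)" for k
    by (subst ennreal_mult[symmetric]) (simp_all add: power_divide)
  then have "1 = (\<Sum>k\<in>{m..<2 * m}. ennreal (2 ^ Suc k / real m) * ennreal ((1/2) ^ k - (1/2) ^ Suc k))"
    using m by (simp add: ennreal_of_nat_eq_real_of_nat flip: ennreal_mult')
  also have "\<dots> \<le> line_integral (dyadic_density x0 m) \<pi>"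
    unfolding dyadic_density_def dyadic_annulus_def \<pi>
  proof (rule line_integral_annuli_ge)
    fix k assume k: "k \<in> {m..<2 * m}"
    have "(1/2::real) ^ k \<le> (1/2) ^ m"
      using k by (intro power_decreasing) auto
    then show "(1/2) ^ k \<le> dist (\<gamma> a) x0"
      using E[OF \<gamma>(3)] by (rule order.trans)
    \<comment> \<open>From \<open>k < 2 * m\<close> follows \<open>Suc k \<le> 2 * m\<close>, so
      even the innermost annulus does not reach below the radius
      \<open>(1/2) ^ (2 * m)\<close>.\<close>
    have "(1/2::real) ^ (2 * m) \<le> (1/2) ^ Suc k"
      using k by (intro power_decreasing) auto
    with F[OF \<gamma>(4)] show "dist (\<gamma> b) x0 \<le> (1/2) ^ Suc k"
      by (rule order.trans)
  qed (use \<gamma> rect \<pi> in auto)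
  finally show "1 \<le> line_integral (dyadic_density x0 m) \<pi>" .
qed measurable

lemma joining_paths_subset_paths_in: "joining_paths E F D \<subseteq> paths_in D"
  by (auto simp: joining_paths_def paths_in_def is_interval_cc)

theorem theorem3p1:
  fixes \<mu> :: "'a::metric_space measure" and \<mu>' :: "'b::metric_space measure"
    and D :: "'a set" and D' :: "'b set"
    and \<alpha> \<alpha>' :: real and x0 :: 'a and lam :: "real \<Rightarrow> real"
    and Q :: "'a \<Rightarrow> ennreal" and f :: "'a \<Rightarrow> 'b"
  assumes "locally_finite_borel \<mu>" and "locally_finite_borel \<mu>'"
    and "is_domain D" and "is_domain D'"
    and "0 \<le> \<alpha>" and "hausdorff_dim D = ennreal \<alpha>"
    and "1 < \<alpha>'" and "hausdorff_dim D' = ennreal \<alpha>'"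
    and "x0 \<in> frontier D"
    and "locally_path_connected_at_boundary D x0"
    and "upper_regular_at \<mu> lam x0"
    and "lam \<in> o[at_right 0](\<lambda>\<epsilon>. \<epsilon> powr \<alpha> * ln (1 / \<epsilon>) powr (\<alpha> - 1))"
    and "compact (closure D')"
    and "strongly_accessible_boundary \<mu>' D'"
    and "Q \<in> borel_measurable (restrict_space \<mu> D)"
    and "Limsup (at_right 0)
           (\<lambda>\<epsilon>. (\<integral>\<^sup>+x \<in> ball x0 \<epsilon> \<inter> D. Q x \<partial>\<mu>) / emeasure \<mu> (ball x0 \<epsilon> \<inter> D)) < \<infinity>"
    and "Q_homeomorphism \<mu> D \<mu>' D' Q f"
  shows "\<exists>F. (\<forall>x\<in>D. F x = f x) \<and> continuous_on (insert x0 D) F"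
proof -
  have \<mu>: "sets \<mu> = sets borel"
    using assms(1) by (simp add: locally_finite_borel_def)
  have D: "open D" and D': "open D'"
    using assms(3,4) by (auto simp: is_domain_def)
  have x0: "x0 \<in> closure D" "x0 \<notin> D"
    using assms(9) D by (auto simp: frontier_def interior_open)
  obtain g where hom: "homeomorphism D D' f g"
    using assms(17) by (auto simp: Q_homeomorphism_def)
  have fD: "f x \<in> D'" if "x \<in> D" for x
    using homeomorphism_image1[OF hom] that by blast
  have gf: "g (f x) = x" if "x \<in> D" for x
    using homeomorphism_apply1[OF hom that] .
  obtain X where X: "\<And>n. X n \<in> D" "X \<longlonglongrightarrow> x0"
    using x0(1) unfolding closure_sequential by blast
  have "\<forall>n. f (X n) \<in> closure D'"
    using X(1) fD closure_subset by blast
  then obtain y r where y: "y \<in> closure D'" and r: "strict_mono r" and "(f \<circ> X \<circ> r) \<longlonglongrightarrow> y"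
    using assms(13) unfolding compact_def by (metis comp_apply)
  define Y where "Y = X \<circ> r"
  have Y: "Y n \<in> D" for n
    by (simp add: Y_def X)
  have Y_lim: "Y \<longlonglongrightarrow> x0"
    unfolding Y_def using X(2) r by (rule LIMSEQ_subseq_LIMSEQ)
  have fY_lim: "(\<lambda>n. f (Y n)) \<longlonglongrightarrow> y"
    using \<open>(f \<circ> X \<circ> r) \<longlonglongrightarrow> y\<close> by (simp add: Y_def comp_def)
  \<comment> \<open>Otherwise continuity of \<open>g\<close> at \<open>y\<close> would make
    \<open>Y\<close> converge to \<open>g y\<close>, a point of \<open>D\<close>, whereas its limit
    \<open>x0\<close> lies outside \<open>D\<close>.\<close>
  have "y \<notin> D'"
  proof
    assume "y \<in> D'"
    have "(\<lambda>n. g (f (Y n))) \<longlonglongrightarrow> g y"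
      by (rule continuous_on_tendsto_compose[OF homeomorphism_cont2[OF hom] fY_lim \<open>y \<in> D'\<close>])
         (simp add: fD Y)
    then have "Y \<longlonglongrightarrow> g y"
      by (simp add: gf Y)
    then have "g y = x0"
      using Y_lim by (rule LIMSEQ_unique)
    then show False
      using x0(2) homeomorphism_image2[OF hom] \<open>y \<in> D'\<close> by blast
  qed
  then have "y \<in> frontier D'"
    using y D' by (simp add: frontier_def interior_open)
  then have acc: "strongly_accessible_at \<mu>' D' y"
    using assms(14) by (simp add: strongly_accessible_boundary_def)
  have lim: "(f \<longlongrightarrow> y) (at x0 within D)"
  proof (rule tendstoI, rule ccontr)
    fix e :: real
    assume e: "0 < e" and far: "\<not> (\<forall>\<^sub>F x in at x0 within D. dist (f x) y < e)"
    have "y \<in> interior (ball y e)"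
      using e by (simp add: interior_open)
    then obtain E V \<delta> where E: "compact E" "E \<subseteq> D'" and V: "y \<in> interior V" "V \<subseteq> ball y e"
      and \<delta>: "0 < (\<delta>::real)"
      and mod: "\<And>F. compact F \<Longrightarrow> connected F \<Longrightarrow> F \<subseteq> D' \<Longrightarrow> F \<inter> frontier (ball y e) \<noteq> {} \<Longrightarrow>
        F \<inter> frontier V \<noteq> {} \<Longrightarrow> ennreal \<delta> \<le> modulus \<mu>' D' (joining_paths E F D')"
      using acc unfolding strongly_accessible_at_def by meson
    \<comment> \<open>The set \<open>E\<close> is fixed before \<open>m\<close>, and its preimage is
      compact in \<open>D\<close>, so it keeps a positive distance \<open>s\<close> from
      \<open>x0\<close>.\<close>
    have "compact (g ` E)"
      by (intro compact_continuous_image continuous_on_subset[OF homeomorphism_cont2[OF hom]] E)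
    moreover have "x0 \<notin> g ` E"
      using x0(2) E(2) homeomorphism_image2[OF hom] by blast
    ultimately have "open (- g ` E)" "x0 \<in> - g ` E"
      by (simp_all add: compact_imp_closed open_Compl)
    then obtain s where s: "0 < s" "ball x0 s \<subseteq> - g ` E"
      by (rule openE)
    \<comment> \<open>The first condition on \<open>m\<close> puts the preimage of \<open>E\<close>
      outside the ring; the bound \<open>\<delta> / 2\<close> in the second is to contradict the
      lower bound \<delta>.\<close>
    have "\<forall>\<^sub>F m in sequentially. (1/2::real) ^ m < s"
      using s(1) by (intro order_tendstoD(2)[OF LIMSEQ_power_zero]) auto
    moreover have "\<forall>\<^sub>F m in sequentially. (\<Sum>k\<in>{m..<2 * m}. ennreal ((2 ^ Suc k / real m) powr \<alpha>) *
        (\<integral>\<^sup>+x \<in> ball x0 ((1/2) ^ k) \<inter> D. Q x \<partial>\<mu>)) \<le> ennreal (\<delta> / 2)"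
      using \<delta> assms(5) eventually_nn_integral_ball_le[OF \<mu> D assms(11,12,16)]
      by (intro eventually_dyadic_sum_le[where I = "\<lambda>\<epsilon>. \<integral>\<^sup>+x \<in> ball x0 \<epsilon> \<inter> D. Q x \<partial>\<mu>"]) auto
    moreover have "\<forall>\<^sub>F m::nat in sequentially. 0 < m"
      by (rule eventually_gt_at_top)
    ultimately have "\<forall>\<^sub>F m in sequentially. (1/2::real) ^ m < s \<and> 0 < m \<and>
        (\<Sum>k\<in>{m..<2 * m}. ennreal ((2 ^ Suc k / real m) powr \<alpha>) *
          (\<integral>\<^sup>+x \<in> ball x0 ((1/2) ^ k) \<inter> D. Q x \<partial>\<mu>)) \<le> ennreal (\<delta> / 2)"
      by eventually_elim simp
    then obtain m where m: "(1/2::real) ^ m < s" "0 < m"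
        "(\<Sum>k\<in>{m..<2 * m}. ennreal ((2 ^ Suc k / real m) powr \<alpha>) *
          (\<integral>\<^sup>+x \<in> ball x0 ((1/2) ^ k) \<inter> D. Q x \<partial>\<mu>)) \<le> ennreal (\<delta> / 2)"
      using eventually_happens[of _ sequentially] by auto
    \<comment> \<open>The radius is the inner one of the ring, so every path in \<open>W\<close>
      stays inside the hole of the ring.\<close>
    let ?B = "ball x0 ((1/2) ^ (2 * m))"
    have "x0 \<in> interior ?B"
      by (simp add: interior_open)
    then obtain W where W: "W \<subseteq> ?B" "x0 \<in> interior W" "path_connected (W \<inter> D)"
      using assms(10) unfolding locally_path_connected_at_boundary_def by meson
    have "\<forall>\<^sub>F n in sequentially. Y n \<in> interior W"
      using topological_tendstoD[OF Y_lim open_interior W(2)] .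
    moreover have "\<forall>\<^sub>F n in sequentially. f (Y n) \<in> interior V"
      using topological_tendstoD[OF fY_lim open_interior V(1)] .
    ultimately have "\<forall>\<^sub>F n in sequentially. Y n \<in> interior W \<and> f (Y n) \<in> interior V"
      by (rule eventually_conj)
    then obtain n where n: "Y n \<in> interior W" "f (Y n) \<in> interior V"
      using eventually_happens[of _ sequentially] by auto
    \<comment> \<open>Points with image far from \<open>y\<close> occur frequently near
      \<open>x0\<close>, while lying in \<open>interior W\<close> and in \<open>D\<close> holds
      eventually; some point does both.\<close>
    obtain z where z: "z \<in> interior W" "z \<in> D" "e \<le> dist (f z) y"
    proof -
      have "\<forall>\<^sub>F x in at x0 within D. x \<in> interior W \<and> x \<in> D"
        using W(2) open_interior[of W] by (auto simp: eventually_at_topological)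
      moreover have "\<exists>\<^sub>F x in at x0 within D. \<not> dist (f x) y < e"
        using far by (simp add: not_eventually)
      ultimately have "\<exists>\<^sub>F x in at x0 within D.
          (x \<in> interior W \<and> x \<in> D) \<and> \<not> dist (f x) y < e"
        by (rule frequently_eventually_conj[rotated])
      then obtain z where "(z \<in> interior W \<and> z \<in> D) \<and> \<not> dist (f z) y < e"
        by (rule frequentlyE)
      then show thesis by (intro that[of z]) auto
    qed
    obtain p where p: "path p" "path_image p \<subseteq> W \<inter> D" "pathstart p = Y n" "pathfinish p = z"
      using W(3) n(1) z Y interior_subset[of W] unfolding path_connected_def by blast
    define C where "C = path_image p"
    have C: "C \<subseteq> D" "C \<subseteq> ?B" "Y n \<in> C" "z \<in> C"
      using p W(1) pathstart_in_path_image[of p] pathfinish_in_path_image[of p] by (auto simp: C_def)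
    have cont: "continuous_on C f"
      using continuous_on_subset[OF homeomorphism_cont1[OF hom] C(1)] .
    have gfC: "g ` f ` C = C"
      using gf C(1) by (force simp: image_image)
    \<comment> \<open>As \<open>V\<close> lies in \<open>ball y e\<close>, the connected image of
      \<open>C\<close> meets both sets and both complements, hence both frontiers.\<close>
    have V_n: "f (Y n) \<in> f ` C \<inter> V" and z_n: "f z \<in> f ` C - ball y e"
      using n(2) interior_subset C z(3) by (auto simp: dist_commute)
    have conn: "connected (f ` C)"
      unfolding C_def using cont p(1) by (intro connected_continuous_image connected_path_image) (auto simp: C_def)
    have "ennreal \<delta> \<le> modulus \<mu>' D' (joining_paths E (f ` C) D')"
    proof (rule mod)
      show "compact (f ` C)"
        using cont p(1) by (intro compact_continuous_image) (auto simp: C_def)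
      show "f ` C \<subseteq> D'"
        using C(1) fD by blast
      show "f ` C \<inter> frontier (ball y e) \<noteq> {}" "f ` C \<inter> frontier V \<noteq> {}"
        using V_n z_n V(2) by (intro connected_Int_frontier conn; blast)+
    qed (rule conn)
    also have "\<dots> \<le> modulus \<mu>' D' (image_family f (joining_paths (g ` E) C D))"
      using modulus_joining_paths_le_image[OF hom, of \<mu>' E "f ` C"] by (simp add: gfC)
    also have "\<dots> \<le> (\<integral>\<^sup>+x \<in> D. Q x * ennreal_powr (dyadic_density x0 m x) \<alpha> \<partial>\<mu>)"
    proof -
      have "admissible (joining_paths (g ` E) C D) (dyadic_density x0 m)"
      proof (rule admissible_dyadic_density[OF m(2)])
        show "(1/2) ^ m \<le> dist x x0" if "x \<in> g ` E" for x
        proof -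
          have "x \<notin> ball x0 s"
            using s(2) that by blast
          then show ?thesis
            using m(1) by (simp add: dist_commute)
        qed
        show "dist x x0 \<le> (1/2) ^ (2 * m)" if "x \<in> C" for x
          using subsetD[OF C(2) that] by (simp add: dist_commute)
      qed
      \<comment> \<open>The exponent in the \<open>Q\<close>-inequality is
        \<open>enn2real (hausdorff_dim D)\<close>, which equals \<alpha> because
        \<open>0 \<le> \<alpha>\<close>.\<close>
      then show ?thesis
        using assms(17) joining_paths_subset_paths_in[of "g ` E" C D] assms(5,6)
        unfolding Q_homeomorphism_def by (metis enn2real_ennreal)
    qed
    also have "\<dots> \<le> ennreal (\<delta> / 2)"
      using nn_integral_dyadic_density_le[OF \<mu> D assms(15)] m(3) by (rule order.trans)
    finally show False
      using \<delta> by (simp add: ennreal_le_iff)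
  qed
  define F where "F x = (if x = x0 then y else f x)" for x
  have "continuous_on (insert x0 D) F"
    unfolding continuous_on_def
  proof
    fix x assume "x \<in> insert x0 D"
    \<comment> \<open>The filter ignores the point \<open>x0\<close> itself, so adding it to
      \<open>D\<close> changes nothing.\<close>
    have ins: "at x0 within insert x0 D = at x0 within D"
      by (simp add: at_within_def)
    show "(F \<longlongrightarrow> F x) (at x within insert x0 D)"
    proof (cases "x = x0")
      case True
      have "(F \<longlongrightarrow> y) (at x0 within D)"
        by (rule Lim_transform_eventually[OF lim]) (auto simp: F_def eventually_at_filter)
      then show ?thesis
        unfolding True ins by (simp add: F_def)
    next
      case False
      then have x: "x \<in> D" using \<open>x \<in> insert x0 D\<close> by simp
      have "(f \<longlongrightarrow> f x) (at x)"
        using homeomorphism_cont1[OF hom] D x by (simp add: continuous_on_eq_continuous_at isCont_def)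
      moreover have "\<forall>\<^sub>F z in at x. f z = F z"
        using eventually_at_in_open'[OF D x] by eventually_elim (use x0(2) in \<open>auto simp: F_def\<close>)
      ultimately have "(F \<longlongrightarrow> f x) (at x)"
        by (rule Lim_transform_eventually)
      then show ?thesis
        using False by (auto simp: F_def intro: tendsto_within_subset)
    qed
  qed
  moreover have "\<forall>x\<in>D. F x = f x"
    using x0(2) by (auto simp: F_def)
  ultimately show ?thesis by blast
qed

end
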